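(* Let $n_1,\dots,n_k$ be positive integers with $n_1+\cdots+n_k=n$. Let $A_1,\dots,A_m$ be $n\times n$ complex positive definite matrices, and for each $i=1,\dots,m$ let $A_i^{(1)},\dots,A_i^{(k)}$ be the diagonal blocks of $A_i$ when it is partitioned according to $(n_1,\dots,n_k)$, so that $A_i^{(j)}$ is an $n_j\times n_j$ positive definite matrix and the main block diagonal of $A_i$ is $A_i^{(1)}\oplus\cdots\oplus A_i^{(k)}$. Then for every real $p\ge 1$, $$\lambda\left(\left(\sum_{i=1}^{m}(A_i^{(1)})^{-1}\oplus\cdots\oplus\sum_{i=1}^{m}(A_i^{(k)})^{-1}\right)^{p}\right)\prec_{w}\lambda\left(\left(\sum_{i=1}^{m}A_i^{-1}\right)^{p}\right).$$
   Context: Positive definite matrices are Hermitian, and the $p$-th power of a positive definite matrix is the usual one given by the spectral theorem. For an $n\times n$ positive definite matrix $A$, $\lambda(A)\in\mathbb{R}^n$ denotes the vector of its $n$ eigenvalues, counted with multiplicity; thus the entries of $\lambda(A^p)$ are the $p$-th powers of the entries of $\lambda(A)$. For $x\in\mathbb{R}^n$, $x_{[1]}\ge x_{[2]}\ge\cdots\ge x_{[n]}$ denote the components of $x$ rearranged in non-increasing order. For $x,y\in\mathbb{R}^n$, $x\prec_w y$ ($x$ is weakly majorized by $y$) means $\sum_{j=1}^{l}x_{[j]}\le\sum_{j=1}^{l}y_{[j]}$ for all $1\le l\le n$. The symbol $\oplus$ denotes the block diagonal direct sum of matrices; the direct sum in the claim has as its $j$-th diagonal block the $n_j\times n_j$ matrix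 $\sum_{i=1}^m (A_i^{(j)})^{-1}$. *)

theory Defs
  imports
    "Jordan_Normal_Form.Schur_Decomposition"
    "Jordan_Normal_Form.Gauss_Jordan_Elimination"
    "Jordan_Normal_Form.DL_Submatrix"
    "HOL-Computational_Algebra.Fundamental_Theorem_Algebra"
begin

definition pos_def_mat :: "nat \<Rightarrow> complex mat \<Rightarrow> bool" where
  "pos_def_mat n A \<longleftrightarrow> A \<in> carrier_mat n n \<and> mat_adjoint A = A \<and>
     (\<forall>v \<in> carrier_vec n. v \<noteq> 0\<^sub>v n \<longrightarrow> 0 < Re ((A *\<^sub>v v) \<bullet>c v))"

text \<open>
  The library's \<open>mat_inverse\<close> is option-valued, returning \<open>None\<close> on singular matrices.
\<close>

definition mat_inv :: "complex mat \<Rightarrow> complex mat" where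
  "mat_inv A = the (mat_inverse A)"

definition unitary_mat :: "nat \<Rightarrow> complex mat \<Rightarrow> bool" where
  "unitary_mat n U \<longleftrightarrow> U \<in> carrier_mat n n \<and>
     mat_adjoint U * U = 1\<^sub>m n \<and> U * mat_adjoint U = 1\<^sub>m n"

text \<open>
  Real power of a positive definite matrix: if \<open>A = U D U\<^sup>*\<close> with \<open>U\<close> unitary and \<open>D\<close>
  diagonal with positive diagonal, then \<open>A\<^sup>p = U D\<^sup>p U\<^sup>*\<close>. A decomposition exists by the
  spectral theorem, and the resulting matrix does not depend on the decomposition chosen.
  The value is unspecified if \<open>A\<close> is not positive definite.
\<close>

definition mat_powr :: "complex mat \<Rightarrow> real \<Rightarrow> complex mat" where
  "mat_powr A p = (SOME B. \<exists>U d. unitary_mat (dim_row A) U \<and>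
     (\<forall>i < dim_row A. (0::real) < d i) \<and>
     A = U * mat_diag (dim_row A) (\<lambda>i. complex_of_real (d i)) * mat_adjoint U \<and>
     B = U * mat_diag (dim_row A) (\<lambda>i. complex_of_real (d i powr p)) * mat_adjoint U)"

text \<open>
  The eigenvalues with algebraic multiplicity, for matrices whose eigenvalues are all real:
  taking \<open>Re\<close> only changes the type. The order of the list is immaterial below.
\<close>

definition eigvals :: "complex mat \<Rightarrow> real list" where
  "eigvals A = sorted_list_of_multiset (image_mset Re (proots (char_poly A)))"

text \<open>
  The non-increasing rearrangement; \<open>x\<^bsub>[j]\<^esub>\<close>, counted from 1, is \<open>decr x ! (j - 1)\<close>.
\<close>

definition decr :: "real list \<Rightarrow> real list" where
  "decr x = rev (sort x)"

definition weakly_majorized :: "real list \<Rightarrow> real list \<Rightarrow> bool" (infix "\<prec>\<^sub>w" 50) where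
  "x \<prec>\<^sub>w y \<longleftrightarrow> length x = length y \<and>
     (\<forall>l \<in> {1..length x}. (\<Sum>j = 1..l. decr x ! (j - 1)) \<le> (\<Sum>j = 1..l. decr y ! (j - 1)))"

text \<open>
  For a partition of the index set into consecutive intervals of lengths \<open>ns ! 0, ns ! 1, \<dots>\<close>,
  the \<open>j\<close>-th interval (\<open>j\<close> counted from 0) and the corresponding diagonal block.
\<close>

definition block_indices :: "nat list \<Rightarrow> nat \<Rightarrow> nat set" where
  "block_indices ns j = {sum_list (take j ns) ..< sum_list (take j ns) + ns ! j}"

definition diag_block :: "nat list \<Rightarrow> complex mat \<Rightarrow> nat \<Rightarrow> complex mat" where
  "diag_block ns A j = submatrix A (block_indices ns j) (block_indices ns j)"

lemma diag_block_conv_mat: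
  assumes A: "A \<in> carrier_mat (sum_list ns) (sum_list ns)" and j: "j < length ns"
  shows "diag_block ns A j = mat (ns ! j) (ns ! j)
    (\<lambda>(r, c). A $$ (sum_list (take j ns) + r, sum_list (take j ns) + c))"
proof -
  let ?o = "sum_list (take j ns)"
  have "sum_list ns = sum_list (take j ns @ ns ! j # drop (Suc j) ns)"
    using id_take_nth_drop[OF j] by simp
  then have "?o + ns ! j \<le> sum_list ns"
    by simp
  then have "{i. i < sum_list ns \<and> i \<in> block_indices ns j} = {?o ..< ?o + ns ! j}"
    by (auto simp: block_indices_def)
  moreover have "pick (block_indices ns j) r = ?o + r" if "r < ns ! j" for r
  proof -
    have "{a \<in> block_indices ns j. a < ?o + r} = {?o ..< ?o + r}"
      using that by (auto simp: block_indices_def)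
    moreover have "?o + r \<in> block_indices ns j"
      using that by (simp add: block_indices_def)
    ultimately show ?thesis
      using pick_card_in_set[of "?o + r" "block_indices ns j"] by simp
  qed
  ultimately show ?thesis
    using A by (auto simp: diag_block_def submatrix_def intro!: eq_matI)
qed

definition mat_sum :: "nat \<Rightarrow> ('i \<Rightarrow> complex mat) \<Rightarrow> 'i set \<Rightarrow> complex mat" where
  "mat_sum n F I = finsum (module_mat TYPE(complex) n n) F I"

end

theory Submission
  imports Defs "HOL-Analysis.Convex"
begin

text \<open>
  Let \<open>B\<close> be the sum of the inverses \<open>A\<^sub>i\<^sup>-\<^sup>1\<close>, and let \<open>C\<close> be the block diagonal matrix with the blocks
  \<open>M\<^sub>j\<close>, the sums over \<open>i\<close> of the inverses of the \<open>j\<close>-th diagonal blocks of the \<open>A\<^sub>i\<close>. Two facts combine.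

  Blocks of inverses dominate inverses of blocks. If \<open>E\<close> is the isometry that extends vectors of the
  \<open>j\<close>-th block by zeros, the \<open>j\<close>-th block of \<open>A\<close> is \<open>E\<^sup>* A E\<close>, and
  \<open>\<langle>(E\<^sup>* A E)\<^sup>-\<^sup>1 x, x\<rangle> \<le> \<langle>A\<^sup>-\<^sup>1 E x, E x\<rangle>\<close> (\<open>inverse_compression_le\<close>). Summing over \<open>i\<close> gives
  \<open>\<langle>M\<^sub>j x, x\<rangle> \<le> \<langle>B E x, E x\<rangle>\<close>. Now \<open>C\<close> has an orthonormal basis of eigenvectors \<open>u\<^sub>a\<close> each of which
  is supported in a single block (\<open>diag_block_mat_spectral_decomp\<close>), so its eigenvalues satisfy
  \<open>d\<^sub>a \<le> \<langle>B u\<^sub>a, u\<^sub>a\<rangle>\<close>.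

  Values of a quadratic form at an orthonormal basis are averages of eigenvalues. If \<open>v\<^sub>k\<close> is an
  orthonormal eigenbasis of \<open>B\<close> with eigenvalues \<open>\<mu>\<^sub>k\<close>, then \<open>\<langle>B u\<^sub>a, u\<^sub>a\<rangle>\<close> is the sum over \<open>k\<close> of
  \<open>q\<^sub>k\<^sub>a \<mu>\<^sub>k\<close>, where \<open>q\<^sub>k\<^sub>a = \<bar>\<langle>u\<^sub>a, v\<^sub>k\<rangle>\<bar>\<^sup>2\<close> is doubly stochastic (\<open>qform_spectral_expansion\<close>). As
  \<open>t \<mapsto> t\<^sup>p\<close> is increasing and convex, \<open>d\<^sub>a\<^sup>p\<close> is at most the same average of the \<open>\<mu>\<^sub>k\<^sup>p\<close>. A vector
  bounded by a doubly stochastic average of another one is weakly majorized by it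
  (\<open>weakly_majorized_of_doubly_stochastic\<close>).

  The eigenvalues of the powers are the powers of the eigenvalues whichever decomposition defines the
  power (\<open>mset_eigvals_mat_powr\<close>), since the diagonal of any decomposition consists of the roots of
  the characteristic polynomial.
\<close>

(* The infix dot then denotes the scalar product of vectors of variable dimension only. *)
unbundle no inner_syntax

section \<open>Adjoints and unitary matrices\<close>

lemma mat_adjoint_eq:
  "mat_adjoint (A :: complex mat) = mat (dim_col A) (dim_row A) (\<lambda>(i, j). cnj (A $$ (j, i)))"
  by (rule eq_matI) (auto simp: mat_adjoint_def mat_of_rows_def)

lemma mat_adjoint_dim [simp]:
  "dim_row (mat_adjoint (A :: complex mat)) = dim_col A" "dim_col (mat_adjoint A) = dim_row A"
  by (simp_all add: mat_adjoint_eq)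

lemma mat_adjoint_index [simp]:
  "i < dim_col A \<Longrightarrow> j < dim_row A \<Longrightarrow> mat_adjoint (A :: complex mat) $$ (i, j) = cnj (A $$ (j, i))"
  by (simp add: mat_adjoint_eq)

lemma mat_adjoint_carrier [simp]:
  "(A :: complex mat) \<in> carrier_mat n m \<Longrightarrow> mat_adjoint A \<in> carrier_mat m n"
  by (intro carrier_matI) auto

lemma mat_adjoint_adjoint [simp]: "mat_adjoint (mat_adjoint (A :: complex mat)) = A"
  by (rule eq_matI) auto

lemma mat_adjoint_one [simp]: "mat_adjoint (1\<^sub>m n :: complex mat) = 1\<^sub>m n"
  by (rule eq_matI) auto

lemma mat_adjoint_zero [simp]: "mat_adjoint (0\<^sub>m n m :: complex mat) = 0\<^sub>m m n"
  by (rule eq_matI) auto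

lemma mat_adjoint_mult:
  assumes "(A :: complex mat) \<in> carrier_mat n m" "B \<in> carrier_mat m l"
  shows "mat_adjoint (A * B) = mat_adjoint B * mat_adjoint A"
  using assms by (intro eq_matI) (auto simp: scalar_prod_def mult.commute intro!: sum.cong)

lemma mat_adjoint_congruence:
  assumes A: "(A :: complex mat) \<in> carrier_mat n n" and X: "X \<in> carrier_mat n k"
  shows "mat_adjoint (mat_adjoint X * A * X) = mat_adjoint X * mat_adjoint A * X"
proof -
  have XA: "mat_adjoint X * A \<in> carrier_mat k n" using assms by (intro mult_carrier_mat) auto
  have "mat_adjoint (mat_adjoint X * A * X) = mat_adjoint X * mat_adjoint (mat_adjoint X * A)"
    by (rule mat_adjoint_mult[OF XA X])
  also have "mat_adjoint (mat_adjoint X * A) = mat_adjoint A * X"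
    using mat_adjoint_mult[OF mat_adjoint_carrier[OF X] A] by simp
  also have "mat_adjoint X * (mat_adjoint A * X) = mat_adjoint X * mat_adjoint A * X"
    using assms by (intro assoc_mult_mat[symmetric]) auto
  finally show ?thesis .
qed

lemma mat_adjoint_add:
  assumes "(A :: complex mat) \<in> carrier_mat n m" "B \<in> carrier_mat n m"
  shows "mat_adjoint (A + B) = mat_adjoint A + mat_adjoint B"
  using assms by (intro eq_matI) auto

lemma mat_adjoint_four_block:
  assumes "(A :: complex mat) \<in> carrier_mat n n" "B \<in> carrier_mat m m"
  shows "mat_adjoint (four_block_mat A (0\<^sub>m n m) (0\<^sub>m m n) B)
    = four_block_mat (mat_adjoint A) (0\<^sub>m n m) (0\<^sub>m m n) (mat_adjoint B)"
  using assms by (intro eq_matI) auto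

text \<open>
  The defining property of the adjoint, obtained by interchanging the two summations.
\<close>

lemma cscalar_mat_adjoint:
  assumes A: "(A :: complex mat) \<in> carrier_mat n m" and v: "v \<in> carrier_vec m" and w: "w \<in> carrier_vec n"
  shows "(A *\<^sub>v v) \<bullet>c w = v \<bullet>c (mat_adjoint A *\<^sub>v w)"
proof -
  have "(A *\<^sub>v v) \<bullet>c w = (\<Sum>i<n. \<Sum>j<m. A $$ (i, j) * v $ j * cnj (w $ i))"
    using assms by (simp add: scalar_prod_def sum_distrib_right atLeast0LessThan)
  also have "\<dots> = (\<Sum>j<m. \<Sum>i<n. A $$ (i, j) * v $ j * cnj (w $ i))"
    by (rule sum.swap)
  also have "\<dots> = v \<bullet>c (mat_adjoint A *\<^sub>v w)"
    using assms by (simp add: scalar_prod_def sum_distrib_left atLeast0LessThan mult_ac)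
  finally show ?thesis .
qed

text \<open>
  The bridge between matrix products and quadratic forms: the forms at the columns of
  \<open>X\<close> can be read off a diagonal of a product of matrices, where associativity applies.
\<close>

lemma congruence_diag_entry:
  assumes M: "(M :: complex mat) \<in> carrier_mat n n" and X: "X \<in> carrier_mat n k" and a: "a < k"
  shows "(mat_adjoint X * M * X) $$ (a, a) = (M *\<^sub>v col X a) \<bullet>c col X a"
proof -
  have "mat_adjoint X * M * X = mat_adjoint X * (M * X)"
    using assms by (intro assoc_mult_mat) auto
  moreover have "row (mat_adjoint X) a = conjugate (col X a)"
    using assms by (intro eq_vecI) auto
  moreover have "col (M * X) a = M *\<^sub>v col X a"
    using assms by (intro col_mult2) auto
  moreover have "conjugate (col X a) \<bullet> (M *\<^sub>v col X a) = (M *\<^sub>v col X a) \<bullet>c col X a"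
    using assms by (intro comm_scalar_prod[of _ n]) auto
  ultimately show ?thesis using assms by simp
qed

lemma unitary_mat_carrier: "unitary_mat n U \<Longrightarrow> U \<in> carrier_mat n n"
  by (simp add: unitary_mat_def)

lemma unitary_matI:
  assumes U: "U \<in> carrier_mat n n" and e: "mat_adjoint U * U = 1\<^sub>m n"
  shows "unitary_mat n U"
  using assms mat_mult_left_right_inverse[OF mat_adjoint_carrier[OF U] U e]
  by (simp add: unitary_mat_def)

lemma unitary_mat_adjoint: "unitary_mat n U \<Longrightarrow> unitary_mat n (mat_adjoint U)"
  by (auto simp: unitary_mat_def)

lemma unitary_mat_mult:
  assumes "unitary_mat n U" "unitary_mat n V"
  shows "unitary_mat n (U * V)"
proof (rule unitary_matI)
  have U: "U \<in> carrier_mat n n" "mat_adjoint U * U = 1\<^sub>m n"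
    and V: "V \<in> carrier_mat n n" "mat_adjoint V * V = 1\<^sub>m n"
    using assms by (auto simp: unitary_mat_def)
  show "U * V \<in> carrier_mat n n" using U V by simp
  have "mat_adjoint (U * V) * (U * V) = mat_adjoint V * (mat_adjoint U * (U * V))"
    using U V by (simp add: mat_adjoint_mult[of _ n n] assoc_mult_mat[of _ n n _ n _ n])
  also have "mat_adjoint U * (U * V) = (mat_adjoint U * U) * V"
    using U V by (intro assoc_mult_mat[symmetric]) auto
  also have "\<dots> = V" using U V by simp
  finally show "mat_adjoint (U * V) * (U * V) = 1\<^sub>m n" using V by simp
qed

section \<open>Spectral theorem for Hermitian matrices\<close>

definition spectral_decomp :: "nat \<Rightarrow> complex mat \<Rightarrow> complex mat \<Rightarrow> (nat \<Rightarrow> real) \<Rightarrow> bool" where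
  "spectral_decomp n A U d \<longleftrightarrow> unitary_mat n U \<and>
     A = U * mat_diag n (\<lambda>i. complex_of_real (d i)) * mat_adjoint U"

lemma spectral_decomp_carrier: "spectral_decomp n A U d \<Longrightarrow> A \<in> carrier_mat n n"
  unfolding spectral_decomp_def unitary_mat_def
  by (metis mat_adjoint_carrier mat_diag_dim mult_carrier_mat)

lemma spectral_decomp_conj:
  assumes W: "unitary_mat n W" and A: "spectral_decomp n A U d"
  shows "spectral_decomp n (W * A * mat_adjoint W) (W * U) d"
proof -
  let ?D = "mat_diag n (\<lambda>i. complex_of_real (d i))"
  have c: "W \<in> carrier_mat n n" "U \<in> carrier_mat n n" "?D \<in> carrier_mat n n"
    using assms by (auto simp: spectral_decomp_def unitary_mat_def)
  have "W * A * mat_adjoint W = W * U * ?D * mat_adjoint (W * U)"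
    using A c unfolding spectral_decomp_def
    by (simp add: mat_adjoint_mult[of _ n n] assoc_mult_mat[of _ n n _ n _ n] mult_carrier_mat[of _ n n _ n])
  then show ?thesis
    using A unitary_mat_mult[OF W] by (simp add: spectral_decomp_def)
qed

text \<open>
  Serves twice: it is the induction step of the spectral theorem, with a block of size one,
  and it assembles the decomposition of a block diagonal matrix from those of its blocks.
\<close>

lemma spectral_decomp_four_block:
  assumes A: "spectral_decomp n A U d" and B: "spectral_decomp m B V e"
  shows "spectral_decomp (n + m) (four_block_mat A (0\<^sub>m n m) (0\<^sub>m m n) B)
    (four_block_mat U (0\<^sub>m n m) (0\<^sub>m m n) V) (\<lambda>i. if i < n then d i else e (i - n))"
    (is "spectral_decomp _ ?A ?U ?d")
proof -
  let ?D = "mat_diag n (\<lambda>i. complex_of_real (d i))" and ?E = "mat_diag m (\<lambda>i. complex_of_real (e i))"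
  have c: "U \<in> carrier_mat n n" "V \<in> carrier_mat m m" "?D \<in> carrier_mat n n" "?E \<in> carrier_mat m m"
    and UV: "mat_adjoint U * U = 1\<^sub>m n" "mat_adjoint V * V = 1\<^sub>m m"
    and AB: "A = U * ?D * mat_adjoint U" "B = V * ?E * mat_adjoint V"
    using assms by (auto simp: spectral_decomp_def unitary_mat_def)
  have diag: "mat_diag (n + m) (\<lambda>i. complex_of_real (?d i))
      = four_block_mat ?D (0\<^sub>m n m) (0\<^sub>m m n) ?E"
    by (rule eq_matI) (auto simp: mat_diag_def)
  have "unitary_mat (n + m) ?U"
    using c by (intro unitary_matI)
      (auto simp: mat_adjoint_four_block mult_four_block_mat[of _ n n _ m _ m _ _ n _ m] UV
        mult_carrier_mat[of _ n n] mult_carrier_mat[of _ m m])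
  moreover have "?A = ?U * mat_diag (n + m) (\<lambda>i. complex_of_real (?d i)) * mat_adjoint ?U"
  proof -
    have "four_block_mat (U * D * mat_adjoint U) (0\<^sub>m n m) (0\<^sub>m m n) (V * E * mat_adjoint V)
        = ?U * four_block_mat D (0\<^sub>m n m) (0\<^sub>m m n) E * mat_adjoint ?U"
      if "D \<in> carrier_mat n n" "E \<in> carrier_mat m m" for D E
      using c that
      by (simp add: mat_adjoint_four_block mult_four_block_mat[of _ n n _ m _ m _ _ n _ m]
          mult_carrier_mat[of _ n n _ n] mult_carrier_mat[of _ m m _ m])
    from this[OF c(3,4)] show ?thesis unfolding diag AB .
  qed
  ultimately show ?thesis by (simp add: spectral_decomp_def)
qed

text \<open>
  The Gram--Schmidt process applied to a basis that starts with \<open>v\<close> gives orthogonal vectors,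
  the first of which is still \<open>v\<close>; the columns of \<open>W\<close> are these vectors, normalised.
\<close>

lemma unitary_completion:
  fixes v :: "complex vec"
  assumes v: "v \<in> carrier_vec n" and v0: "v \<noteq> 0\<^sub>v n" and n: "0 < n"
  obtains W c where "unitary_mat n W" "col W 0 = c \<cdot>\<^sub>v v"
proof -
  interpret cof_vec_space n "TYPE(complex)" .
  define ws where "ws = gram_schmidt n (basis_completion v)"
  note b = basis_completion[OF v v0]
  note g = gram_schmidt_result[OF b(2,4,5) ws_def]
  have ws: "set ws \<subseteq> carrier_vec n" "length ws = n" "corthogonal ws"
    using g b(6) by auto
  have "basis_completion v = v # tl (basis_completion v)"
    using b(6,7) n by (cases "basis_completion v") auto
  then have "hd ws = v"
    using gram_schmidt_hd[OF v] by (metis ws_def)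
  then have ws0: "ws ! 0 = v" using ws(2) n by (cases ws) auto
  define r where "r i = complex_of_real (1 / sqrt (Re (ws ! i \<bullet>c ws ! i)))" for i
  define W where "W = mat_of_cols n (map (\<lambda>i. r i \<cdot>\<^sub>v ws ! i) [0..<n])"
  have wsc: "ws ! i \<in> carrier_vec n" if "i < n" for i using ws that by auto
  have colW: "col W i = r i \<cdot>\<^sub>v ws ! i" if "i < n" for i
    using that wsc[OF that] unfolding W_def by (subst col_mat_of_cols) auto
  have W: "W \<in> carrier_mat n n" unfolding W_def by auto
  have "mat_adjoint W * W = 1\<^sub>m n"
  proof (rule eq_matI)
    fix i j assume "i < dim_row (1\<^sub>m n)" "j < dim_col (1\<^sub>m n)"
    then have ij: "i < n" "j < n" by auto
    have "row (mat_adjoint W) i = conjugate (col W i)"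
      using ij W by (intro eq_vecI) auto
    then have "(mat_adjoint W * W) $$ (i, j) = conjugate (col W i) \<bullet> col W j"
      using ij W by simp
    also have "\<dots> = col W j \<bullet>c col W i"
      using W by (intro comm_scalar_prod[of _ n]) auto
    also have "\<dots> = r j * (r i * (ws ! j \<bullet>c ws ! i))"
    proof -
      have r: "conjugate (r i) = r i" by (simp add: r_def)
      show ?thesis
        using ij wsc[OF ij(1)] wsc[OF ij(2)]
        by (simp add: colW conjugate_smult_vec r smult_scalar_prod_distrib[of _ n]
            scalar_prod_smult_distrib[of _ n] del: conjugate_complex_def)
    qed
    also have "\<dots> = 1\<^sub>m n $$ (i, j)"
    proof (cases "i = j")
      case False
      then show ?thesis using corthogonalD[OF ws(3), of j i] ij ws(2) by auto
    next
      case True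
      have ne: "ws ! i \<bullet>c ws ! i \<noteq> 0" using corthogonalD[OF ws(3), of i i] ij ws(2) by auto
      have "ws ! i \<bullet>c ws ! i \<ge> 0" by auto
      then have im: "ws ! i \<bullet>c ws ! i = complex_of_real (Re (ws ! i \<bullet>c ws ! i))"
        and pos: "Re (ws ! i \<bullet>c ws ! i) > 0"
        using ne by (auto simp: less_eq_complex_def complex_eq_iff)
      have "r i * (r i * complex_of_real x) = 1" if "x = Re (ws ! i \<bullet>c ws ! i)" for x
        using pos unfolding r_def that[symmetric]
        by (simp add: that flip: of_real_mult)
      then show ?thesis using True ij im by auto
    qed
    finally show "(mat_adjoint W * W) $$ (i, j) = 1\<^sub>m n $$ (i, j)" .
  qed (use W in auto)
  then have "unitary_mat n W" by (intro unitary_matI[OF W])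
  with colW[OF n] ws0 show thesis by (intro that) auto
qed

text \<open>
  Deflation: if \<open>W\<close> is unitary with an eigenvector of \<open>A\<close> as its first column, then the first
  column of \<open>W\<^sup>* A W\<close> is a multiple of the first unit vector. Since \<open>W\<^sup>* A W\<close> is Hermitian, so is its
  first row, and the induction hypothesis applies to the remaining block.
\<close>

theorem spectral_theorem:
  assumes "A \<in> carrier_mat n n" "mat_adjoint A = A"
  shows "\<exists>U d. spectral_decomp n A U d"
  using assms
proof (induction n arbitrary: A)
  case 0
  then have "spectral_decomp 0 A (1\<^sub>m 0) (\<lambda>_. 0)"
    by (auto simp: spectral_decomp_def unitary_mat_def)
  then show ?case by blast
next
  case (Suc m)
  note A = Suc.prems(1) and herm = Suc.prems(2)
  obtain as where as: "char_poly A = (\<Prod>a\<leftarrow>as. [:- a, 1:])" "length as = Suc m"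
    using char_poly_factorized[OF A] by blast
  then obtain e where "e \<in> set as" by (cases as) auto
  then have "poly (char_poly A) e = 0" unfolding as by (simp add: poly_prod_list_zero_iff image_iff) 
  then have "eigenvalue A e" using eigenvalue_root_char_poly[OF A] by simp
  then obtain v where v: "v \<in> carrier_vec (Suc m)" "v \<noteq> 0\<^sub>v (Suc m)" "A *\<^sub>v v = e \<cdot>\<^sub>v v"
    using A by (auto simp: eigenvalue_def eigenvector_def)
  obtain W c where W: "unitary_mat (Suc m) W" and W0: "col W 0 = c \<cdot>\<^sub>v v"
    using unitary_completion[OF v(1,2)] by auto
  have Wc: "W \<in> carrier_mat (Suc m) (Suc m)" using W by (rule unitary_mat_carrier)
  define B where "B = mat_adjoint W * A * W"
  have W0c: "col W 0 \<in> carrier_vec (Suc m)" using Wc by (simp add: col_def)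
  have B: "B \<in> carrier_mat (Suc m) (Suc m)" using Wc A by (auto simp: B_def)
  have Bherm: "mat_adjoint B = B"
    unfolding B_def mat_adjoint_congruence[OF A Wc] herm ..
  have "col B 0 = (mat_adjoint W * A) *\<^sub>v col W 0"
    unfolding B_def using Wc A by (intro col_mult2) auto
  also have "\<dots> = mat_adjoint W *\<^sub>v (A *\<^sub>v col W 0)"
    using Wc A W0c by (intro assoc_mult_mat_vec) auto
  also have "A *\<^sub>v col W 0 = e \<cdot>\<^sub>v col W 0"
    using A v by (simp add: W0 mult_mat_vec[of _ "Suc m" "Suc m"] smult_smult_assoc mult.commute)
  also have "mat_adjoint W *\<^sub>v (e \<cdot>\<^sub>v col W 0) = e \<cdot>\<^sub>v (mat_adjoint W *\<^sub>v col W 0)"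
    using Wc W0c by (intro mult_mat_vec) auto
  also have "mat_adjoint W *\<^sub>v col W 0 = col (mat_adjoint W * W) 0"
    using Wc by (intro col_mult2[symmetric]) auto
  also have "mat_adjoint W * W = 1\<^sub>m (Suc m)" using W by (simp add: unitary_mat_def)
  finally have col0: "col B 0 = e \<cdot>\<^sub>v unit_vec (Suc m) 0" by simp
  have B0: "B $$ (i, 0) = (if i = 0 then e else 0)" if "i < Suc m" for i
    using arg_cong[OF col0, of "\<lambda>v. v $ i"] that B by simp
  have Bsym: "B $$ (i, j) = cnj (B $$ (j, i))" if "i < Suc m" "j < Suc m" for i j
    using arg_cong[OF Bherm, of "\<lambda>M. M $$ (i, j)"] that B by simp
  define A3 where "A3 = mat m m (\<lambda>(i, j). B $$ (Suc i, Suc j))"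
  have A3: "A3 \<in> carrier_mat m m" by (simp add: A3_def)
  have "mat_adjoint A3 = A3"
    by (rule eq_matI) (auto simp: A3_def Bsym[symmetric])
  then obtain U d where U: "spectral_decomp m A3 U d"
    using Suc.IH[OF A3] by blast
  \<comment> \<open>The eigenvalue is a diagonal entry of a Hermitian matrix, hence real.\<close>
  have "e = cnj e" using Bsym[of 0 0] B0[of 0] by simp
  then have e: "e = complex_of_real (Re e)" by (simp add: complex_eq_iff)
  have "spectral_decomp 1 (mat 1 1 (\<lambda>_. e)) (1\<^sub>m 1) (\<lambda>_. Re e)"
    unfolding spectral_decomp_def unitary_mat_def
    by (subst e) (auto simp: mat_diag_def)
  from spectral_decomp_four_block[OF this U]
  have "\<exists>U d. spectral_decomp (Suc m) (four_block_mat (mat 1 1 (\<lambda>_. e)) (0\<^sub>m 1 m) (0\<^sub>m m 1) A3) U d"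
    by auto
  also have "four_block_mat (mat 1 1 (\<lambda>_. e)) (0\<^sub>m 1 m) (0\<^sub>m m 1) A3 = B"
  proof (rule eq_matI)
    fix i j assume "i < dim_row B" "j < dim_col B"
    then have ij: "i < Suc m" "j < Suc m" using B by auto
    then show "four_block_mat (mat 1 1 (\<lambda>_. e)) (0\<^sub>m 1 m) (0\<^sub>m m 1) A3 $$ (i, j) = B $$ (i, j)"
      using B0[of i] B0[of j] Bsym[of 0 j] by (auto simp: A3_def split: if_splits)
  qed (use B in \<open>auto simp: A3_def\<close>)
  finally obtain U' d' where "spectral_decomp (Suc m) B U' d'" by blast
  from spectral_decomp_conj[OF W this]
  have "spectral_decomp (Suc m) (W * B * mat_adjoint W) (W * U') d'" .
  moreover have "W * B * mat_adjoint W = (W * mat_adjoint W) * A * (W * mat_adjoint W)"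
    using Wc A unfolding B_def 
    by (simp add: assoc_mult_mat[of _ "Suc m" "Suc m" _ "Suc m" _ "Suc m"] mult_carrier_mat[of _ "Suc m" "Suc m" _ "Suc m"])
  moreover have "\<dots> = A" using W A by (simp add: unitary_mat_def)
  ultimately show ?case by auto
qed

section \<open>Quadratic forms and positive definite matrices\<close>

text \<open>
  Only the real part is kept; the forms of interest belong to Hermitian matrices and are real.
\<close>

definition qform :: "complex mat \<Rightarrow> complex vec \<Rightarrow> real" where
  "qform A v = Re ((A *\<^sub>v v) \<bullet>c v)"

lemma pos_def_mat_iff_qform:
  "pos_def_mat n A \<longleftrightarrow> A \<in> carrier_mat n n \<and> mat_adjoint A = A \<and>
     (\<forall>v \<in> carrier_vec n. v \<noteq> 0\<^sub>v n \<longrightarrow> 0 < qform A v)"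
  by (simp add: pos_def_mat_def qform_def)

lemma pos_def_matD:
  assumes "pos_def_mat n A"
  shows "A \<in> carrier_mat n n" "mat_adjoint A = A"
    "\<And>v. v \<in> carrier_vec n \<Longrightarrow> v \<noteq> 0\<^sub>v n \<Longrightarrow> 0 < qform A v"
  using assms by (auto simp: pos_def_mat_iff_qform)

lemma qform_add:
  assumes "A \<in> carrier_mat n n" "B \<in> carrier_mat n n" "v \<in> carrier_vec n"
  shows "qform (A + B) v = qform A v + qform B v"
  using assms by (simp add: qform_def add_mult_distrib_mat_vec[of _ n n] add_scalar_prod_distrib[of _ n])

lemma qform_zero_mat: "v \<in> carrier_vec n \<Longrightarrow> qform (0\<^sub>m n n) v = 0"
proof -
  assume v: "v \<in> carrier_vec n"
  then have "0\<^sub>m n n *\<^sub>v v = 0\<^sub>v n" by (intro eq_vecI) auto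
  with v show ?thesis by (simp add: qform_def)
qed

lemma qform_zero_vec: "A \<in> carrier_mat n n \<Longrightarrow> qform A (0\<^sub>v n) = 0"
  by (auto simp: qform_def scalar_prod_def)

lemma qform_nonneg:
  assumes "pos_def_mat n A" "v \<in> carrier_vec n"
  shows "0 \<le> qform A v"
  using pos_def_matD[OF assms(1)] assms(2) qform_zero_vec[of A n]
  by (cases "v = 0\<^sub>v n") (auto intro: less_imp_le)

lemma qform_congruence:
  assumes "A \<in> carrier_mat n n" "X \<in> carrier_mat n k" "v \<in> carrier_vec k"
  shows "qform (mat_adjoint X * A * X) v = qform A (X *\<^sub>v v)"
proof -
  have "(mat_adjoint X * A * X) *\<^sub>v v = (mat_adjoint X * A) *\<^sub>v (X *\<^sub>v v)"
    using assms by (intro assoc_mult_mat_vec) auto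
  also have "\<dots> = mat_adjoint X *\<^sub>v (A *\<^sub>v (X *\<^sub>v v))"
    using assms by (intro assoc_mult_mat_vec) auto
  finally have "(mat_adjoint X * A * X) *\<^sub>v v = mat_adjoint X *\<^sub>v (A *\<^sub>v (X *\<^sub>v v))" .
  moreover have "(mat_adjoint X *\<^sub>v (A *\<^sub>v (X *\<^sub>v v))) \<bullet>c v
      = (A *\<^sub>v (X *\<^sub>v v)) \<bullet>c (X *\<^sub>v v)"
    using assms cscalar_mat_adjoint[of "mat_adjoint X" k n "A *\<^sub>v (X *\<^sub>v v)" v] by simp
  ultimately show ?thesis by (simp add: qform_def)
qed

lemma qform_col:
  assumes "A \<in> carrier_mat n n" "X \<in> carrier_mat n k" "a < k"
  shows "qform A (col X a) = Re ((mat_adjoint X * A * X) $$ (a, a))"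
  using congruence_diag_entry[OF assms] by (simp add: qform_def)

lemma mat_sum_insert:
  assumes "finite I" "i \<notin> I" "\<And>j. j \<in> insert i I \<Longrightarrow> F j \<in> carrier_mat n n"
  shows "mat_sum n F (insert i I) = F i + mat_sum n F I" "mat_sum n F I \<in> carrier_mat n n"
proof -
  interpret abelian_group "module_mat TYPE(complex) n n" by (rule abelian_group_mat)
  show "mat_sum n F (insert i I) = F i + mat_sum n F I"
    unfolding mat_sum_def using assms
    by (subst finsum_insert) (auto simp: module_mat_simps)
  show "mat_sum n F I \<in> carrier_mat n n"
    unfolding mat_sum_def using assms finsum_closed[of F I] by (auto simp: module_mat_simps)
qed

lemma mat_sum_empty: "mat_sum n F {} = 0\<^sub>m n n"
proof -
  interpret abelian_group "module_mat TYPE(complex) n n" by (rule abelian_group_mat)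
  show ?thesis unfolding mat_sum_def by (simp add: module_mat_simps)
qed

lemma qform_mat_sum:
  assumes "finite I" "\<And>i. i \<in> I \<Longrightarrow> F i \<in> carrier_mat n n" "v \<in> carrier_vec n"
  shows "qform (mat_sum n F I) v = (\<Sum>i\<in>I. qform (F i) v)"
  using assms
proof (induction I rule: finite_induct)
  case (insert i I)
  then show ?case using mat_sum_insert[of I i F n] by (simp add: qform_add[of _ n])
qed (simp add: mat_sum_empty qform_zero_mat)

lemma mat_sum_adjoint:
  assumes "finite I" "\<And>i. i \<in> I \<Longrightarrow> F i \<in> carrier_mat n n \<and> mat_adjoint (F i) = F i"
  shows "mat_sum n F I \<in> carrier_mat n n \<and> mat_adjoint (mat_sum n F I) = mat_sum n F I"
  using assms
proof (induction I rule: finite_induct)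
  case (insert i I)
  then show ?case using mat_sum_insert[of I i F n] by (simp add: mat_adjoint_add[of _ n n])
qed (simp add: mat_sum_empty)

lemma pos_def_mat_sum:
  assumes I: "finite I" "I \<noteq> {}" and F: "\<And>i. i \<in> I \<Longrightarrow> pos_def_mat n (F i)"
  shows "pos_def_mat n (mat_sum n F I)"
proof -
  have "0 < qform (mat_sum n F I) v" if "v \<in> carrier_vec n" "v \<noteq> 0\<^sub>v n" for v
    using that I pos_def_matD[OF F] by (subst qform_mat_sum) (auto intro!: sum_pos)
  then show ?thesis
    using mat_sum_adjoint[OF I(1), of F n] pos_def_matD(1,2)[OF F] by (auto simp: pos_def_mat_iff_qform)
qed

lemma pos_def_mat_inverse:
  assumes A: "pos_def_mat n A"
  shows "mat_inv A \<in> carrier_mat n n" "A * mat_inv A = 1\<^sub>m n" "mat_inv A * A = 1\<^sub>m n"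
proof -
  note Ac = pos_def_matD(1)[OF A]
  have "det A \<noteq> 0"
  proof
    assume "det A = 0"
    then obtain v where v: "v \<in> carrier_vec n" "v \<noteq> 0\<^sub>v n" "A *\<^sub>v v = 0\<^sub>v n"
      using det_0_iff_vec_prod_zero[OF Ac] by blast
    then have "qform A v = 0" by (simp add: qform_def)
    with pos_def_matD(3)[OF A v(1,2)] show False by simp
  qed
  then have "A \<in> Units (ring_mat TYPE(complex) n ())"
    by (rule det_non_zero_imp_unit[OF Ac])
  then obtain B where "mat_inverse A = Some B"
    using mat_inverse(1)[OF Ac, where b = "()"] by (cases "mat_inverse A") auto
  then show "mat_inv A \<in> carrier_mat n n" "A * mat_inv A = 1\<^sub>m n" "mat_inv A * A = 1\<^sub>m n"
    using mat_inverse(2)[OF Ac] by (auto simp: mat_inv_def)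
qed

lemma mat_inv_mult_vec:
  assumes A: "pos_def_mat n A" and v: "v \<in> carrier_vec n"
  shows "A *\<^sub>v (mat_inv A *\<^sub>v v) = v"
  using assoc_mult_mat_vec[OF pos_def_matD(1)[OF A] pos_def_mat_inverse(1)[OF A] v]
    pos_def_mat_inverse(2)[OF A] v by simp

text \<open>
  The form of \<open>A\<^sup>-\<^sup>1\<close> at \<open>v\<close> is the form of \<open>A\<close> at \<open>A\<^sup>-\<^sup>1 v\<close>, because \<open>A\<^sup>-\<^sup>1 = (A\<^sup>-\<^sup>1)\<^sup>* A A\<^sup>-\<^sup>1\<close>.
\<close>

lemma pos_def_mat_inv:
  assumes A: "pos_def_mat n A"
  shows "pos_def_mat n (mat_inv A)"
proof -
  let ?B = "mat_inv A"
  note Ac = pos_def_matD(1)[OF A] and B = pos_def_mat_inverse[OF A]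
  have BA: "mat_adjoint ?B * A = 1\<^sub>m n"
    using mat_adjoint_mult[OF Ac B(1)] B(2) pos_def_matD(2)[OF A] by simp
  have "mat_adjoint ?B = mat_adjoint ?B * (A * ?B)"
    using B by simp
  also have "\<dots> = mat_adjoint ?B * A * ?B"
    using Ac B by (intro assoc_mult_mat[symmetric]) auto
  also have "\<dots> = ?B"
    using BA B by simp
  finally have adj: "mat_adjoint ?B = ?B" .
  have "0 < qform ?B v" if v: "v \<in> carrier_vec n" "v \<noteq> 0\<^sub>v n" for v
  proof -
    have w: "?B *\<^sub>v v \<in> carrier_vec n" using B v by auto
    have "A *\<^sub>v 0\<^sub>v n = 0\<^sub>v n"
      using Ac by (intro eq_vecI) (auto simp: scalar_prod_def)
    then have "?B *\<^sub>v v \<noteq> 0\<^sub>v n"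
      using mat_inv_mult_vec[OF A v(1)] v(2) by metis
    then have "0 < qform A (?B *\<^sub>v v)" using pos_def_matD(3)[OF A w] by simp
    also have "qform A (?B *\<^sub>v v) = qform (mat_adjoint ?B * A * ?B) v"
      by (rule qform_congruence[OF Ac B(1) v(1), symmetric])
    also have "mat_adjoint ?B * A * ?B = ?B" using BA B by simp
    finally show ?thesis .
  qed
  with adj B show ?thesis by (simp add: pos_def_mat_iff_qform)
qed

lemma cscalar_isometry:
  assumes E: "E \<in> carrier_mat n k" "mat_adjoint E * E = 1\<^sub>m k"
    and x: "x \<in> carrier_vec k" and y: "y \<in> carrier_vec k"
  shows "(E *\<^sub>v x) \<bullet>c (E *\<^sub>v y) = x \<bullet>c (y :: complex vec)"
proof -
  have "(E *\<^sub>v x) \<bullet>c (E *\<^sub>v y) = x \<bullet>c (mat_adjoint E *\<^sub>v (E *\<^sub>v y))"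
    using E x y by (intro cscalar_mat_adjoint) auto
  also have "mat_adjoint E *\<^sub>v (E *\<^sub>v y) = (mat_adjoint E * E) *\<^sub>v y"
    using E y by (intro assoc_mult_mat_vec[symmetric]) auto
  finally show ?thesis using E y by simp
qed

lemma pos_def_congruence:
  assumes A: "pos_def_mat n A" and E: "E \<in> carrier_mat n k" "mat_adjoint E * E = 1\<^sub>m k"
  shows "pos_def_mat k (mat_adjoint E * A * E)"
proof -
  note Ac = pos_def_matD(1)[OF A]
  have "0 < qform (mat_adjoint E * A * E) v" if v: "v \<in> carrier_vec k" "v \<noteq> 0\<^sub>v k" for v
  proof -
    have "E *\<^sub>v v \<noteq> 0\<^sub>v n"
    proof
      assume z: "E *\<^sub>v v = 0\<^sub>v n"
      have "v \<bullet>c v = 0"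
        using cscalar_isometry[OF E v(1) v(1)] unfolding z by simp
      with v show False by simp
    qed
    moreover have "E *\<^sub>v v \<in> carrier_vec n" using E v by auto
    ultimately show ?thesis
      using pos_def_matD(3)[OF A] by (simp add: qform_congruence[OF Ac E(1) v(1)])
  qed
  moreover have "mat_adjoint E * A * E \<in> carrier_mat k k"
    using Ac E by (intro mult_carrier_mat[of _ k n] mult_carrier_mat[of _ k n _ n]) auto
  ultimately show ?thesis
    using mat_adjoint_congruence[OF Ac E(1)] pos_def_matD(2)[OF A]
    by (simp add: pos_def_mat_iff_qform)
qed

text \<open>
  This is \<open>0 \<le> \<langle>A (u - v), u - v\<rangle>\<close> multiplied out; the two mixed terms are complex conjugates.
\<close>

lemma two_Re_le_qform_add:
  assumes A: "pos_def_mat n A" and u: "u \<in> carrier_vec n" and v: "v \<in> carrier_vec n"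
  shows "2 * Re ((A *\<^sub>v u) \<bullet>c v) \<le> qform A u + qform A v"
proof -
  note Ac = pos_def_matD(1)[OF A]
  have cv: "conjugate (u - v) = conjugate u - conjugate v"
    using u v by (intro eq_vecI) auto
  have "0 \<le> qform A (u - v)" using qform_nonneg[OF A] u v by simp
  also have "qform A (u - v)
      = qform A u + qform A v - Re ((A *\<^sub>v u) \<bullet>c v) - Re ((A *\<^sub>v v) \<bullet>c u)"
    using Ac u v
    by (simp add: qform_def cv mult_minus_distrib_mat_vec[of _ n n] minus_scalar_prod_distrib[of _ n]
        scalar_prod_minus_distrib[of _ n])
  also have "Re ((A *\<^sub>v v) \<bullet>c u) = Re ((A *\<^sub>v u) \<bullet>c v)"
  proof -
    have "(A *\<^sub>v v) \<bullet>c u = v \<bullet>c (A *\<^sub>v u)"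
      using cscalar_mat_adjoint[OF Ac v u] pos_def_matD(2)[OF A] by simp
    also have "\<dots> = conjugate ((A *\<^sub>v u) \<bullet>c v)"
      using Ac u v by (subst conjugate_sprod_vec[of _ n]) (auto intro!: comm_scalar_prod[of _ n])
    finally show ?thesis by simp
  qed
  finally show ?thesis by simp
qed

text \<open>
  Inverting a compression gives at most the compression of the inverse. The reason is the variational
  formula \<open>\<langle>A\<^sup>-\<^sup>1 y, y\<rangle> = sup\<^sub>w (2 Re \<langle>y, w\<rangle> - \<langle>A w, w\<rangle>)\<close>: for the compressed matrix the supremum runs
  over the range of \<open>E\<close> only. Concretely, with \<open>C = E\<^sup>* A E\<close>, the preceding inequality is used at
  \<open>u = A\<^sup>-\<^sup>1 E x\<close> and at \<open>E z\<close>, where \<open>z = C\<^sup>-\<^sup>1 x\<close> is the maximiser for the compressed problem.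
\<close>

theorem inverse_compression_le:
  assumes A: "pos_def_mat n A" and E: "E \<in> carrier_mat n k" "mat_adjoint E * E = 1\<^sub>m k"
    and x: "x \<in> carrier_vec k"
  shows "qform (mat_inv (mat_adjoint E * A * E)) x \<le> qform (mat_inv A) (E *\<^sub>v x)"
proof -
  let ?C = "mat_adjoint E * A * E"
  note Ac = pos_def_matD(1)[OF A]
  have C: "pos_def_mat k ?C" by (rule pos_def_congruence[OF A E])
  define z where "z = mat_inv ?C *\<^sub>v x"
  define u where "u = mat_inv A *\<^sub>v (E *\<^sub>v x)"
  have z: "z \<in> carrier_vec k" using pos_def_mat_inverse(1)[OF C] x by (simp add: z_def)
  have Ex: "E *\<^sub>v x \<in> carrier_vec n" using E x by auto
  have Ez: "E *\<^sub>v z \<in> carrier_vec n" using E z by auto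
  have u: "u \<in> carrier_vec n" using pos_def_mat_inverse(1)[OF A] Ex by (simp add: u_def)
  have Au: "A *\<^sub>v u = E *\<^sub>v x" unfolding u_def by (rule mat_inv_mult_vec[OF A Ex])
  have Cz: "?C *\<^sub>v z = x" unfolding z_def by (rule mat_inv_mult_vec[OF C x])
  have "2 * Re (x \<bullet>c z) = 2 * Re ((A *\<^sub>v u) \<bullet>c (E *\<^sub>v z))"
    by (simp add: Au cscalar_isometry[OF E x z])
  also have "\<dots> \<le> qform A u + qform A (E *\<^sub>v z)"
    by (rule two_Re_le_qform_add[OF A u Ez])
  also have "qform A (E *\<^sub>v z) = Re (x \<bullet>c z)"
    using qform_congruence[OF Ac E(1) z] by (simp add: qform_def Cz)
  finally have *: "Re (x \<bullet>c z) \<le> qform A u" by simp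
  have Re_comm: "Re (v \<bullet>c w) = Re (w \<bullet>c v)" if "v \<in> carrier_vec l" "w \<in> carrier_vec l" for v w :: "complex vec" and l
  proof -
    have "v \<bullet>c w = conjugate (w \<bullet>c v)"
      using that by (subst conjugate_sprod_vec[of _ l]) (auto intro!: comm_scalar_prod[of _ l])
    then show ?thesis by simp
  qed
  have "qform (mat_inv ?C) x = Re (x \<bullet>c z)"
    using Re_comm[OF z x] by (simp add: qform_def z_def)
  moreover have "qform (mat_inv A) (E *\<^sub>v x) = qform A u"
    using Re_comm[OF u Ex] by (simp add: qform_def Au) (simp add: u_def)
  ultimately show ?thesis using * by simp
qed

section \<open>Weak majorization\<close>

lemma decr_cong: "mset x = mset y \<Longrightarrow> decr x = decr y"
  by (metis decr_def mset_sort properties_for_sort sorted_sort)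

lemma weakly_majorized_cong:
  assumes "mset x = mset x'" "mset y = mset y'"
  shows "x \<prec>\<^sub>w y \<longleftrightarrow> x' \<prec>\<^sub>w y'"
  using decr_cong[OF assms(1)] decr_cong[OF assms(2)] assms[THEN mset_eq_length]
  by (simp add: weakly_majorized_def)

text \<open>
  The rearrangement as a permutation of the indices, so that sums over the largest entries become
  sums over \<open>\<pi> ` {..<l}\<close>.
\<close>

lemma decr_permutation:
  fixes f :: "nat \<Rightarrow> real"
  obtains \<pi> where "\<pi> permutes {..<n}" "\<And>j. j < n \<Longrightarrow> decr (map f [0..<n]) ! j = f (\<pi> j)"
    "\<And>i j. i \<le> j \<Longrightarrow> j < n \<Longrightarrow> f (\<pi> j) \<le> f (\<pi> i)"
proof -
  have "mset (decr (map f [0..<n])) = mset (map f [0..<n])" by (simp add: decr_def)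
  then obtain \<pi> where \<pi>: "\<pi> permutes {..<length (map f [0..<n])}"
    "permute_list \<pi> (map f [0..<n]) = decr (map f [0..<n])"
    by (rule mset_eq_permutation)
  have \<pi>n: "\<pi> permutes {..<n}" using \<pi>(1) by simp
  have nth: "decr (map f [0..<n]) ! j = f (\<pi> j)" if "j < n" for j
    using permutes_in_image[OF \<pi>n, of j] that unfolding \<pi>(2)[symmetric] by (simp add: permute_list_nth[OF \<pi>(1)])
  have "f (\<pi> j) \<le> f (\<pi> i)" if "i \<le> j" "j < n" for i j
  proof -
    have "decr (map f [0..<n]) ! j \<le> decr (map f [0..<n]) ! i"
      unfolding decr_def using that
      by (intro sorted_rev_nth_mono) auto
    then show ?thesis using that nth by simp
  qed
  with \<pi>n nth show thesis by (rule that)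
qed

text \<open>
  Weights between 0 and 1 of total mass \<open>l\<close> do best when concentrated on the \<open>l\<close> largest values.
  After subtracting the threshold \<open>t = y (l - 1)\<close> from all values, those before position \<open>l\<close> are
  nonnegative and those from \<open>l\<close> on are nonpositive, so the comparison holds term by term; the total
  mass is what makes the subtraction harmless.
\<close>

lemma weighted_sum_le_top_sum:
  fixes y w :: "nat \<Rightarrow> real"
  assumes mono: "\<And>i j. i \<le> j \<Longrightarrow> j < n \<Longrightarrow> y j \<le> y i"
    and w: "\<And>j. j < n \<Longrightarrow> 0 \<le> w j" "\<And>j. j < n \<Longrightarrow> w j \<le> 1"
    and sum: "(\<Sum>j<n. w j) = real l" and l: "l \<le> n" "0 < l"
  shows "(\<Sum>j<n. w j * y j) \<le> (\<Sum>j<l. y j)"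
proof -
  define t where "t = y (l - 1)"
  have "(\<Sum>j<n. w j * (y j - t)) \<le> (\<Sum>j<n. if j < l then y j - t else 0)"
  proof (rule sum_mono)
    fix j assume "j \<in> {..<n}"
    then have j: "j < n" by simp
    show "w j * (y j - t) \<le> (if j < l then y j - t else 0)"
    proof (cases "j < l")
      case True
      then have "0 \<le> y j - t" unfolding t_def using mono[of j "l - 1"] l by auto
      then show ?thesis using w[OF j] True by (simp add: mult_left_le_one_le)
    next
      case False
      then have "y j - t \<le> 0" unfolding t_def using mono[of "l - 1" j] l j by auto
      then show ?thesis using w[OF j] False by (simp add: mult_nonneg_nonpos)
    qed
  qed
  also have "\<dots> = (\<Sum>j<l. y j - t)"
    using l by (intro sum.mono_neutral_cong_right) auto
  finally have "(\<Sum>j<n. w j * y j) - (\<Sum>j<n. w j) * t \<le> (\<Sum>j<l. y j) - real l * t"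
    by (simp add: sum_subtractf right_diff_distrib sum_distrib_right)
  then show ?thesis by (simp add: sum)
qed

text \<open>
  Adding up the bounds for the indices of the \<open>l\<close> largest values of \<open>f\<close> gives a weighted sum of the
  values of \<open>g\<close>. The row sums bound every weight by 1, and the column sums give total mass \<open>l\<close>.
\<close>

theorem weakly_majorized_of_doubly_stochastic:
  fixes f g :: "nat \<Rightarrow> real" and q :: "nat \<Rightarrow> nat \<Rightarrow> real"
  assumes q: "\<And>k a. k < n \<Longrightarrow> a < n \<Longrightarrow> 0 \<le> q k a"
    and col: "\<And>a. a < n \<Longrightarrow> (\<Sum>k<n. q k a) = 1"
    and row: "\<And>k. k < n \<Longrightarrow> (\<Sum>a<n. q k a) = 1"
    and f: "\<And>a. a < n \<Longrightarrow> f a \<le> (\<Sum>k<n. q k a * g k)"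
  shows "map f [0..<n] \<prec>\<^sub>w map g [0..<n]"
  unfolding weakly_majorized_def
proof (intro conjI ballI)
  fix l assume "l \<in> {1..length (map f [0..<n])}"
  then have l: "1 \<le> l" "l \<le> n" by auto
  obtain \<pi> where \<pi>: "\<pi> permutes {..<n}" "\<And>j. j < n \<Longrightarrow> decr (map f [0..<n]) ! j = f (\<pi> j)"
    by (metis decr_permutation[of n f])
  obtain \<sigma> where \<sigma>: "\<sigma> permutes {..<n}" "\<And>j. j < n \<Longrightarrow> decr (map g [0..<n]) ! j = g (\<sigma> j)"
    and mono: "\<And>i j. i \<le> j \<Longrightarrow> j < n \<Longrightarrow> g (\<sigma> j) \<le> g (\<sigma> i)"
    by (rule decr_permutation[of n g]) (blast intro: that)
  have \<pi>n: "\<pi> j < n" if "j < n" for j using permutes_in_image[OF \<pi>(1), of j] that by simp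
  have \<sigma>n: "\<sigma> j < n" if "j < n" for j using permutes_in_image[OF \<sigma>(1), of j] that by simp
  define w where "w k = (\<Sum>j<l. q k (\<pi> j))" for k
  have w0: "0 \<le> w k" if "k < n" for k
    unfolding w_def using that l \<pi>n q by (intro sum_nonneg) auto
  have w1: "w k \<le> 1" if "k < n" for k
  proof -
    have "w k \<le> (\<Sum>j<n. q k (\<pi> j))"
      unfolding w_def using that l \<pi>n q by (intro sum_mono2) auto
    also have "\<dots> = (\<Sum>a<n. q k a)"
      by (rule sum.permute[OF \<pi>(1), symmetric, unfolded o_def])
    finally show ?thesis using row[OF that] by simp
  qed
  have sumw: "(\<Sum>k<n. w k) = real l"
  proof -
    have "(\<Sum>k<n. w k) = (\<Sum>j<l. \<Sum>k<n. q k (\<pi> j))"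
      unfolding w_def by (rule sum.swap)
    also have "\<dots> = (\<Sum>j<l. 1)"
      using l \<pi>n by (intro sum.cong) (auto intro!: col)
    finally show ?thesis by simp
  qed
  have shift: "(\<Sum>j = 1..l. h (j - 1)) = (\<Sum>j<l. h j)" for h :: "nat \<Rightarrow> real"
    by (rule sum.reindex_bij_witness[of _ Suc "\<lambda>j. j - 1"]) auto
  have "(\<Sum>j = 1..l. decr (map f [0..<n]) ! (j - 1)) = (\<Sum>j<l. f (\<pi> j))"
    unfolding shift using l \<pi>(2) by (intro sum.cong) auto
  also have "\<dots> \<le> (\<Sum>j<l. \<Sum>k<n. q k (\<pi> j) * g k)"
    using l \<pi>n by (intro sum_mono) (auto intro!: f)
  also have "\<dots> = (\<Sum>k<n. w k * g k)"
    unfolding w_def sum_distrib_right by (rule sum.swap)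
  also have "\<dots> = (\<Sum>k<n. w (\<sigma> k) * g (\<sigma> k))"
    by (rule sum.permute[OF \<sigma>(1), unfolded o_def])
  also have "\<dots> \<le> (\<Sum>j<l. g (\<sigma> j))"
  proof (rule weighted_sum_le_top_sum)
    show "(\<Sum>j<n. w (\<sigma> j)) = real l"
      using sum.permute[OF \<sigma>(1), of w] sumw by (simp add: o_def)
  qed (use l mono w0 w1 \<sigma>n in auto)
  also have "\<dots> = (\<Sum>j = 1..l. decr (map g [0..<n]) ! (j - 1))"
    unfolding shift using l \<sigma>(2) by (intro sum.cong) auto
  finally show "(\<Sum>j = 1..l. decr (map f [0..<n]) ! (j - 1))
      \<le> (\<Sum>j = 1..l. decr (map g [0..<n]) ! (j - 1))" .
qed simp

text \<open>
  Jensen's inequality for \<open>t \<mapsto> t\<^sup>p\<close>.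
\<close>

lemma powr_weighted_sum_le:
  fixes c x :: "nat \<Rightarrow> real"
  assumes p: "1 \<le> p" and c: "\<And>k. k < n \<Longrightarrow> 0 \<le> c k" "(\<Sum>k<n. c k) = 1"
    and x: "\<And>k. k < n \<Longrightarrow> 0 < x k"
  shows "(\<Sum>k<n. c k * x k) powr p \<le> (\<Sum>k<n. c k * x k powr p)"
proof -
  have "{..<n} \<noteq> {}" using c(2) by auto
  from convex_on_sum[OF _ this powr_convex[OF p] c(2), of x] show ?thesis
    using c(1) x by simp
qed

section \<open>Eigenvalues and quadratic forms\<close>

lemma spectral_decomp_unitary: "spectral_decomp n A U d \<Longrightarrow> unitary_mat n U"
  by (simp add: spectral_decomp_def)

lemma spectral_decomp_diagonal:
  assumes S: "spectral_decomp n A U d"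
  shows "mat_adjoint U * A * U = mat_diag n (\<lambda>i. complex_of_real (d i))"
proof -
  let ?D = "mat_diag n (\<lambda>i. complex_of_real (d i))"
  have U: "U \<in> carrier_mat n n" "mat_adjoint U * U = 1\<^sub>m n"
    and A: "A = U * ?D * mat_adjoint U" and D: "?D \<in> carrier_mat n n"
    using S by (auto simp: spectral_decomp_def unitary_mat_def)
  have "mat_adjoint U * A * U = (mat_adjoint U * U) * ?D * (mat_adjoint U * U)"
    using U(1) D unfolding A
    by (simp add: assoc_mult_mat[of _ n n _ n _ n] mult_carrier_mat[of _ n n _ n])
  also have "\<dots> = ?D" unfolding U(2) left_mult_one_mat[OF D] right_mult_one_mat[OF D] ..
  finally show ?thesis .
qed

lemma qform_spectral_col:
  assumes S: "spectral_decomp n A U d" and a: "a < n"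
  shows "qform A (col U a) = d a"
  using qform_col[OF spectral_decomp_carrier[OF S] unitary_mat_carrier[OF spectral_decomp_unitary[OF S]] a]
    spectral_decomp_diagonal[OF S] a
  by (simp add: mat_diag_def)

lemma spectral_decomp_pos:
  assumes A: "pos_def_mat n A" and S: "spectral_decomp n A U d" and a: "a < n"
  shows "0 < d a"
proof -
  have U: "U \<in> carrier_mat n n" "mat_adjoint U * U = 1\<^sub>m n"
    using spectral_decomp_unitary[OF S] by (auto simp: unitary_mat_def)
  have c: "col U a \<in> carrier_vec n" using U by (auto simp: col_def)
  have "col U a \<noteq> 0\<^sub>v n"
  proof
    assume "col U a = 0\<^sub>v n"
    then have "(mat_adjoint U * U) $$ (a, a) = row (mat_adjoint U) a \<bullet> 0\<^sub>v n"
      using U(1) a by simp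
    also have "\<dots> = 0" using U(1) a by (auto simp: scalar_prod_def)
    finally show False using U(2) a by simp
  qed
  from pos_def_matD(3)[OF A c this] show ?thesis by (simp add: qform_spectral_col[OF S a])
qed

lemma pos_def_spectral_decomp:
  assumes "pos_def_mat n A"
  obtains U d where "spectral_decomp n A U d" "\<And>a. a < n \<Longrightarrow> 0 < d a"
  using spectral_theorem[OF pos_def_matD(1,2)[OF assms]] spectral_decomp_pos[OF assms] by blast

lemma qform_mat_diag:
  assumes v: "v \<in> carrier_vec n"
  shows "qform (mat_diag n (\<lambda>i. complex_of_real (\<mu> i))) v = (\<Sum>k<n. (cmod (v $ k))\<^sup>2 * \<mu> k)"
proof -
  have "mat_diag n (\<lambda>i. complex_of_real (\<mu> i)) *\<^sub>v v = vec n (\<lambda>k. complex_of_real (\<mu> k) * v $ k)"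
  proof (rule eq_vecI)
    fix k assume "k < dim_vec (vec n (\<lambda>k. complex_of_real (\<mu> k) * v $ k))"
    then have k: "k < n" by simp
    have "(mat_diag n (\<lambda>i. complex_of_real (\<mu> i)) *\<^sub>v v) $ k
        = (\<Sum>i<n. (if k = i then complex_of_real (\<mu> i) else 0) * v $ i)"
      using v k by (simp add: mat_diag_def scalar_prod_def atLeast0LessThan)
    also have "\<dots> = (\<Sum>i<n. if k = i then complex_of_real (\<mu> i) * v $ i else 0)"
      by (intro sum.cong) auto
    also have "\<dots> = complex_of_real (\<mu> k) * v $ k" using k by simp
    finally show "(mat_diag n (\<lambda>i. complex_of_real (\<mu> i)) *\<^sub>v v) $ k
        = vec n (\<lambda>k. complex_of_real (\<mu> k) * v $ k) $ k" using k by simp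
  qed (simp add: mat_diag_def)
  then have "qform (mat_diag n (\<lambda>i. complex_of_real (\<mu> i))) v
      = Re (\<Sum>k<n. complex_of_real (\<mu> k) * v $ k * cnj (v $ k))"
    using v by (simp add: qform_def scalar_prod_def atLeast0LessThan)
  also have "\<dots> = (\<Sum>k<n. (cmod (v $ k))\<^sup>2 * \<mu> k)"
    unfolding Re_sum
    by (intro sum.cong refl) (simp only: cmod_power2, simp add: power2_eq_square algebra_simps)
  finally show ?thesis .
qed

text \<open>
  In the eigenbasis of \<open>B\<close> the vector \<open>col X a\<close> has the coordinates \<open>(V\<^sup>* X) $$ (k, a)\<close>. For unitary \<open>X\<close>
  their squared moduli form a doubly stochastic matrix, by the two lemmas that follow.
\<close>

lemma qform_spectral_expansion:
  assumes S: "spectral_decomp n B V \<mu>" and X: "X \<in> carrier_mat n n" and a: "a < n"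
  shows "qform B (col X a) = (\<Sum>k<n. (cmod ((mat_adjoint V * X) $$ (k, a)))\<^sup>2 * \<mu> k)"
proof -
  let ?D = "mat_diag n (\<lambda>i. complex_of_real (\<mu> i))" and ?Z = "mat_adjoint V * X"
  have V: "V \<in> carrier_mat n n" and B: "B = V * ?D * mat_adjoint V" and D: "?D \<in> carrier_mat n n"
    using S by (auto simp: spectral_decomp_def unitary_mat_def)
  have Z: "?Z \<in> carrier_mat n n" using V X by (intro mult_carrier_mat) auto
  have "mat_adjoint X * B * X = mat_adjoint ?Z * ?D * ?Z"
    unfolding B using V X D
    by (simp add: mat_adjoint_mult[of _ n n _ n] assoc_mult_mat[of _ n n _ n _ n] mult_carrier_mat[of _ n n _ n])
  then have "qform B (col X a) = qform ?D (col ?Z a)"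
    using qform_col[OF spectral_decomp_carrier[OF S] X a] qform_col[OF D Z a] by simp
  also have "\<dots> = (\<Sum>k<n. (cmod (col ?Z a $ k))\<^sup>2 * \<mu> k)"
    by (rule qform_mat_diag) (use Z in \<open>auto simp: col_def\<close>)
  also have "\<dots> = (\<Sum>k<n. (cmod (?Z $$ (k, a)))\<^sup>2 * \<mu> k)"
    using V X a by (intro sum.cong refl) (subst index_col, auto)
  finally show ?thesis .
qed

lemma unitary_col_norm:
  assumes "unitary_mat n Z" "a < n"
  shows "(\<Sum>k<n. (cmod (Z $$ (k, a)))\<^sup>2) = 1"
proof -
  have Z: "Z \<in> carrier_mat n n" "mat_adjoint Z * Z = 1\<^sub>m n" using assms by (auto simp: unitary_mat_def)
  have "complex_of_real (\<Sum>k<n. (cmod (Z $$ (k, a)))\<^sup>2) = (\<Sum>k<n. cnj (Z $$ (k, a)) * Z $$ (k, a))"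
    by (simp add: complex_norm_square mult.commute del: of_real_power)
  also have "\<dots> = (mat_adjoint Z * Z) $$ (a, a)"
    using Z(1) assms(2) by (simp add: scalar_prod_def atLeast0LessThan)
  also have "\<dots> = 1" using Z(2) assms(2) by simp
  finally show ?thesis using of_real_eq_1_iff by blast
qed

lemma unitary_row_norm:
  assumes Z: "unitary_mat n Z" and k: "k < n"
  shows "(\<Sum>a<n. (cmod (Z $$ (k, a)))\<^sup>2) = 1"
  using unitary_col_norm[OF unitary_mat_adjoint[OF Z] k] unitary_mat_carrier[OF Z] k by simp

lemma proots_prod_linear: "proots (\<Prod>a\<leftarrow>as. [:- a, 1:]) = mset (as :: complex list)"
proof (induction as)
  case (Cons a as)
  have "(\<Prod>a\<leftarrow>as. [:- a, 1:]) \<noteq> (0 :: complex poly)" by (auto simp: prod_list_zero_iff)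
  with Cons show ?case by (simp add: proots_mult del: mult_pCons_left)
qed simp

lemma proots_char_poly_spectral:
  assumes S: "spectral_decomp n A U d"
  shows "proots (char_poly A) = image_mset complex_of_real (mset (map d [0..<n]))"
proof -
  let ?D = "mat_diag n (\<lambda>i. complex_of_real (d i))"
  have "similar_mat A ?D"
    using S spectral_decomp_carrier[OF S]
    by (intro similar_matI[of _ _ U "mat_adjoint U" n]) (auto simp: spectral_decomp_def unitary_mat_def)
  then have "char_poly A = char_poly ?D" by (rule char_poly_similar)
  also have "\<dots> = (\<Prod>a\<leftarrow>diag_mat ?D. [:- a, 1:])"
    by (rule char_poly_upper_triangular[of _ n]) (auto simp: mat_diag_def)
  also have "diag_mat ?D = map (\<lambda>i. complex_of_real (d i)) [0..<n]"
    by (auto simp: diag_mat_def mat_diag_def)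
  finally have "proots (char_poly A) = mset (map (\<lambda>i. complex_of_real (d i)) [0..<n])"
    by (simp only: proots_prod_linear)
  then show ?thesis by (simp add: o_def multiset.map_comp)
qed

lemma mset_eigvals_spectral:
  assumes "spectral_decomp n A U d"
  shows "mset (eigvals A) = mset (map d [0..<n])"
  by (simp add: eigvals_def proots_char_poly_spectral[OF assms] multiset.map_comp o_def)

text \<open>
  The power is formed from some spectral decomposition of \<open>A\<close>, possibly another one than \<open>U, d\<close>, but both
  have the roots of the characteristic polynomial of \<open>A\<close>, with multiplicity, on the diagonal.
\<close>

lemma mset_eigvals_mat_powr:
  assumes S: "spectral_decomp n A U d" and pos: "\<And>i. i < n \<Longrightarrow> 0 < d i"
  shows "mset (eigvals (mat_powr A p)) = mset (map (\<lambda>i. d i powr p) [0..<n])"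
proof -
  have n: "dim_row A = n" using spectral_decomp_carrier[OF S] by auto
  let ?P = "\<lambda>B. \<exists>U d. unitary_mat n U \<and> (\<forall>i < n. (0::real) < d i) \<and>
     A = U * mat_diag n (\<lambda>i. complex_of_real (d i)) * mat_adjoint U \<and>
     B = U * mat_diag n (\<lambda>i. complex_of_real (d i powr p)) * mat_adjoint U"
  have "\<exists>B. ?P B" using S pos unfolding spectral_decomp_def by blast
  then have "?P (mat_powr A p)" unfolding mat_powr_def n by (rule someI_ex)
  then obtain V e where V: "spectral_decomp n A V e" "spectral_decomp n (mat_powr A p) V (\<lambda>i. e i powr p)"
    unfolding spectral_decomp_def by blast
  have "mset (map e [0..<n]) = mset (map d [0..<n])"
    using mset_eigvals_spectral[OF S] mset_eigvals_spectral[OF V(1)] by simp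
  then have "image_mset (\<lambda>t. t powr p) (mset (map e [0..<n])) = image_mset (\<lambda>t. t powr p) (mset (map d [0..<n]))"
    by simp
  then show ?thesis
    using mset_eigvals_spectral[OF V(2)] by (simp add: multiset.map_comp o_def)
qed

section \<open>Diagonal blocks\<close>

text \<open>
  The isometry that places a vector of length \<open>k\<close> at positions \<open>b, \<dots>, b + k - 1\<close> of a vector of
  length \<open>n\<close> and fills up with zeros.
\<close>

definition block_embedding :: "nat \<Rightarrow> nat \<Rightarrow> nat \<Rightarrow> complex mat" where
  "block_embedding n b k = mat n k (\<lambda>(i, r). if i = b + r then 1 else 0)"

lemma block_embedding_carrier [simp]: "block_embedding n b k \<in> carrier_mat n k"
  by (simp add: block_embedding_def)

lemma block_embedding_mult_vec:
  assumes x: "x \<in> carrier_vec k"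
  shows "block_embedding n b k *\<^sub>v x = vec n (\<lambda>i. if b \<le> i \<and> i < b + k then x $ (i - b) else 0)"
proof (rule eq_vecI)
  fix i assume "i < dim_vec (vec n (\<lambda>i. if b \<le> i \<and> i < b + k then x $ (i - b) else 0))"
  then have i: "i < n" by simp
  have "(block_embedding n b k *\<^sub>v x) $ i = (\<Sum>r<k. if i = b + r then x $ r else 0)"
    using x i by (auto simp: block_embedding_def scalar_prod_def atLeast0LessThan intro!: sum.cong)
  also have "\<dots> = (if b \<le> i \<and> i < b + k then x $ (i - b) else 0)"
  proof (cases "b \<le> i \<and> i < b + k")
    case True
    then have "(\<Sum>r<k. if i = b + r then x $ r else 0) = (\<Sum>r<k. if r = i - b then x $ r else 0)"
      by (intro sum.cong) auto
    then show ?thesis using True by (auto simp: sum.delta)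
  next
    case False
    then show ?thesis by (auto intro!: sum.neutral)
  qed
  finally show "(block_embedding n b k *\<^sub>v x) $ i
      = vec n (\<lambda>i. if b \<le> i \<and> i < b + k then x $ (i - b) else 0) $ i" using i by simp
qed (simp add: block_embedding_def)

lemma mult_block_embedding:
  assumes M: "M \<in> carrier_mat m n" and b: "b + k \<le> n"
  shows "M * block_embedding n b k = mat m k (\<lambda>(i, c). M $$ (i, b + c))"
proof (rule eq_matI)
  fix i c assume "i < dim_row (mat m k (\<lambda>(i, c). M $$ (i, b + c)))"
    "c < dim_col (mat m k (\<lambda>(i, c). M $$ (i, b + c)))"
  then have ic: "i < m" "c < k" by auto
  have "(M * block_embedding n b k) $$ (i, c) = (\<Sum>j<n. M $$ (i, j) * (if j = b + c then 1 else 0))"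
    using M ic by (simp add: block_embedding_def scalar_prod_def atLeast0LessThan)
  also have "\<dots> = (\<Sum>j<n. if j = b + c then M $$ (i, j) else 0)"
    by (intro sum.cong) auto
  also have "\<dots> = M $$ (i, b + c)" using ic b by simp
  finally show "(M * block_embedding n b k) $$ (i, c) = mat m k (\<lambda>(i, c). M $$ (i, b + c)) $$ (i, c)"
    using ic by simp
qed (use M in \<open>auto simp: block_embedding_def\<close>)

lemma block_embedding_adjoint_mult:
  assumes M: "M \<in> carrier_mat n m" and b: "b + k \<le> n"
  shows "mat_adjoint (block_embedding n b k) * M = mat k m (\<lambda>(r, j). M $$ (b + r, j))"
proof (rule eq_matI)
  fix r j assume "r < dim_row (mat k m (\<lambda>(r, j). M $$ (b + r, j)))"
    "j < dim_col (mat k m (\<lambda>(r, j). M $$ (b + r, j)))"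
  then have rj: "r < k" "j < m" by auto
  have "(mat_adjoint (block_embedding n b k) * M) $$ (r, j) = (\<Sum>i<n. cnj (if i = b + r then 1 else 0) * M $$ (i, j))"
    using M rj by (simp add: block_embedding_def scalar_prod_def atLeast0LessThan)
  also have "\<dots> = (\<Sum>i<n. if i = b + r then M $$ (i, j) else 0)"
    by (intro sum.cong) auto
  also have "\<dots> = M $$ (b + r, j)" using rj b by simp
  finally show "(mat_adjoint (block_embedding n b k) * M) $$ (r, j) = mat k m (\<lambda>(r, j). M $$ (b + r, j)) $$ (r, j)"
    using rj by simp
qed (use M in \<open>auto simp: block_embedding_def\<close>)

lemma block_embedding_isometry:
  assumes "b + k \<le> n"
  shows "mat_adjoint (block_embedding n b k) * block_embedding n b k = 1\<^sub>m k"
  unfolding block_embedding_adjoint_mult[OF block_embedding_carrier assms]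
  using assms by (intro eq_matI) (auto simp: block_embedding_def)

text \<open>
  Taking a diagonal block is compressing to the range of the isometry, so that
  \<open>inverse_compression_le\<close> applies to blocks.
\<close>

lemma block_embedding_compression:
  assumes A: "A \<in> carrier_mat n n" and b: "b + k \<le> n"
  shows "mat_adjoint (block_embedding n b k) * A * block_embedding n b k
    = mat k k (\<lambda>(r, c). A $$ (b + r, b + c))"
  unfolding block_embedding_adjoint_mult[OF A b]
  by (subst mult_block_embedding[of _ k n]) (use b in \<open>auto intro!: eq_matI\<close>)

text \<open>
  A block diagonal matrix may have eigenvectors that spread over several blocks, when two blocks share
  an eigenvalue. The decomposition built here avoids them: every column of \<open>U\<close> is supported in one
  block \<open>j\<close>, and the eigenvalue is the value of the quadratic form of that block.
\<close>

lemma diag_block_mat_spectral_decomp: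
  assumes "\<forall>M \<in> set Ms. \<exists>U d. spectral_decomp (dim_row M) M U d \<and> (\<forall>i < dim_row M. 0 < d i)"
  shows "\<exists>U d. spectral_decomp (sum_list (map dim_row Ms)) (diag_block_mat Ms) U d \<and>
    (\<forall>a < sum_list (map dim_row Ms). 0 < d a \<and>
      (\<exists>j < length Ms. \<exists>x \<in> carrier_vec (dim_row (Ms ! j)). d a = qform (Ms ! j) x \<and>
        col U a = block_embedding (sum_list (map dim_row Ms)) (sum_list (map dim_row (take j Ms)))
          (dim_row (Ms ! j)) *\<^sub>v x))"
  using assms
proof (induction Ms)
  case Nil
  have "spectral_decomp 0 (0\<^sub>m 0 0) (1\<^sub>m 0) (\<lambda>_. 0)"
    by (auto simp: spectral_decomp_def unitary_mat_def)
  then show ?case by auto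
next
  case (Cons M Ms)
  let ?n = "dim_row M" and ?m = "sum_list (map dim_row Ms)"
  obtain U d where U: "spectral_decomp ?n M U d" and d: "\<And>i. i < ?n \<Longrightarrow> 0 < d i"
    using Cons.prems by auto
  from Cons.IH Cons.prems obtain V e where V: "spectral_decomp ?m (diag_block_mat Ms) V e"
    and e: "\<And>a. a < ?m \<Longrightarrow> 0 < e a \<and>
      (\<exists>j < length Ms. \<exists>x \<in> carrier_vec (dim_row (Ms ! j)). e a = qform (Ms ! j) x \<and>
        col V a = block_embedding ?m (sum_list (map dim_row (take j Ms))) (dim_row (Ms ! j)) *\<^sub>v x)"
    by auto
  let ?U = "four_block_mat U (0\<^sub>m ?n ?m) (0\<^sub>m ?m ?n) V" and ?d = "\<lambda>i. if i < ?n then d i else e (i - ?n)"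
  have Uc: "U \<in> carrier_mat ?n ?n" and Vc: "V \<in> carrier_mat ?m ?m"
    using U V by (auto simp: spectral_decomp_def unitary_mat_def)
  have "diag_block_mat (M # Ms) = four_block_mat M (0\<^sub>m ?n ?m) (0\<^sub>m ?m ?n) (diag_block_mat Ms)"
    unfolding diag_block_mat.simps Let_def carrier_matD(2)[OF spectral_decomp_carrier[OF U]]
      carrier_matD[OF spectral_decomp_carrier[OF V]] ..
  then have S: "spectral_decomp (?n + ?m) (diag_block_mat (M # Ms)) ?U ?d"
    using spectral_decomp_four_block[OF U V] by simp
  have "0 < ?d a \<and> (\<exists>j < length (M # Ms). \<exists>x \<in> carrier_vec (dim_row ((M # Ms) ! j)).
      ?d a = qform ((M # Ms) ! j) x \<and>
      col ?U a = block_embedding (?n + ?m) (sum_list (map dim_row (take j (M # Ms))))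
        (dim_row ((M # Ms) ! j)) *\<^sub>v x)" if a: "a < ?n + ?m" for a
  proof (cases "a < ?n")
    case True
    have x: "col U a \<in> carrier_vec ?n" using Uc by (auto simp: col_def)
    have "col ?U a = block_embedding (?n + ?m) 0 ?n *\<^sub>v col U a"
      unfolding block_embedding_mult_vec[OF x] using Uc Vc True by (intro eq_vecI) auto
    then show ?thesis
      using True d x qform_spectral_col[OF U True] by (auto intro!: exI[of _ 0] bexI[of _ "col U a"])
  next
    case False
    then have a': "a - ?n < ?m" using a by simp
    from e[OF a'] obtain j x where jx: "j < length Ms" "x \<in> carrier_vec (dim_row (Ms ! j))"
      "e (a - ?n) = qform (Ms ! j) x" "0 < e (a - ?n)"
      "col V (a - ?n) = block_embedding ?m (sum_list (map dim_row (take j Ms))) (dim_row (Ms ! j)) *\<^sub>v x"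
      by blast
    have "col ?U a = block_embedding (?n + ?m) (?n + sum_list (map dim_row (take j Ms))) (dim_row (Ms ! j)) *\<^sub>v x"
    proof (rule eq_vecI)
      fix i assume "i < dim_vec (block_embedding (?n + ?m) (?n + sum_list (map dim_row (take j Ms))) (dim_row (Ms ! j)) *\<^sub>v x)"
      then have i: "i < ?n + ?m" by (simp add: block_embedding_def)
      have "col ?U a $ i = (if i < ?n then 0 else col V (a - ?n) $ (i - ?n))"
        using Uc Vc False a i by auto
      then show "col ?U a $ i = (block_embedding (?n + ?m) (?n + sum_list (map dim_row (take j Ms))) (dim_row (Ms ! j)) *\<^sub>v x) $ i"
        unfolding jx(5) block_embedding_mult_vec[OF jx(2)] using i by auto
    qed (use Uc Vc in \<open>simp add: block_embedding_def\<close>)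
    then show ?thesis
      using False jx by (auto intro!: exI[of _ "Suc j"] bexI[of _ x])
  qed
  with S show ?case by (auto intro!: exI[of _ ?U] exI[of _ ?d])
qed

section \<open>Block diagonals of sums of inverses\<close>

theorem theorem3p2:
  fixes n m :: nat
    and ns :: "nat list"
    and A :: "nat \<Rightarrow> complex mat"
    and p :: real
  assumes "ns \<noteq> []"
    and "\<forall>j < length ns. 0 < ns ! j"
    and "sum_list ns = n"
    and "m \<ge> 1"
    and "\<forall>i \<in> {1..m}. pos_def_mat n (A i)"
    and "p \<ge> 1"
  shows "eigvals (mat_powr
            (diag_block_mat
              (map (\<lambda>j. mat_sum (ns ! j) (\<lambda>i. mat_inv (diag_block ns (A i) j)) {1..m})
                [0..<length ns])) p)
         \<prec>\<^sub>w eigvals (mat_powr (mat_sum n (\<lambda>i. mat_inv (A i)) {1..m}) p)"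
proof -
  define M where "M j = mat_sum (ns ! j) (\<lambda>i. mat_inv (diag_block ns (A i) j)) {1..m}" for j
  define Ms where "Ms = map M [0..<length ns]"
  define B where "B = mat_sum n (\<lambda>i. mat_inv (A i)) {1..m}"
  define E where "E j = block_embedding n (sum_list (take j ns)) (ns ! j)" for j
  have A: "pos_def_mat n (A i)" if "i \<in> {1..m}" for i using assms(5) that by blast
  note I = finite_atLeastAtMost[of 1 m]
  have I0: "{1..m} \<noteq> {}" using assms(4) by simp
  have fit: "sum_list (take j ns) + ns ! j \<le> n" if j: "j < length ns" for j
  proof -
    have "sum_list ns = sum_list (take j ns @ ns ! j # drop (Suc j) ns)"
      using id_take_nth_drop[OF j] by simp
    then show ?thesis using assms(3) by simp
  qed
  have Ec: "E j \<in> carrier_mat n (ns ! j)" for j by (simp add: E_def)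
  have EE: "mat_adjoint (E j) * E j = 1\<^sub>m (ns ! j)" if "j < length ns" for j
    unfolding E_def by (rule block_embedding_isometry[OF fit[OF that]])
  have block: "diag_block ns (A i) j = mat_adjoint (E j) * A i * E j"
    if "i \<in> {1..m}" "j < length ns" for i j
    using diag_block_conv_mat[of "A i" ns j] block_embedding_compression[OF _ fit[OF that(2)], of "A i"]
      pos_def_matD(1)[OF A[OF that(1)]] that(2) assms(3)
    by (simp add: E_def)
  have blockpd: "pos_def_mat (ns ! j) (mat_inv (diag_block ns (A i) j))"
    if "i \<in> {1..m}" "j < length ns" for i j
    unfolding block[OF that] by (intro pos_def_mat_inv pos_def_congruence[OF A Ec EE] that)
  have Mpd: "pos_def_mat (ns ! j) (M j)" if "j < length ns" for j
    unfolding M_def using blockpd that by (intro pos_def_mat_sum I I0)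
  have Bpd: "pos_def_mat n B"
    unfolding B_def using A by (intro pos_def_mat_sum I I0 pos_def_mat_inv)
  \<comment> \<open>The block inequality for inverses, summed over the matrices \<open>A i\<close>.\<close>
  have compare: "qform (M j) x \<le> qform B (E j *\<^sub>v x)"
    if j: "j < length ns" and x: "x \<in> carrier_vec (ns ! j)" for j x
  proof -
    have Ex: "E j *\<^sub>v x \<in> carrier_vec n" using Ec[of j] x by auto
    have "qform (M j) x = (\<Sum>i\<in>{1..m}. qform (mat_inv (diag_block ns (A i) j)) x)"
      unfolding M_def using pos_def_matD(1)[OF blockpd] j by (intro qform_mat_sum[OF I _ x]) auto
    also have "\<dots> \<le> (\<Sum>i\<in>{1..m}. qform (mat_inv (A i)) (E j *\<^sub>v x))"
      using inverse_compression_le[OF A Ec EE[OF j] x] by (intro sum_mono) (simp add: block j)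
    also have "\<dots> = qform B (E j *\<^sub>v x)"
      unfolding B_def using pos_def_mat_inverse(1)[OF A] by (intro qform_mat_sum[symmetric] I Ex) auto
    finally show ?thesis .
  qed
  have dimM: "dim_row (M j) = ns ! j" if "j < length ns" for j
    using pos_def_matD(1)[OF Mpd[OF that]] by auto
  have dims: "map dim_row Ms = ns"
    by (rule nth_equalityI) (simp_all add: Ms_def dimM)
  have Ms_spec: "\<forall>N \<in> set Ms. \<exists>U d. spectral_decomp (dim_row N) N U d \<and> (\<forall>i < dim_row N. 0 < d i)"
  proof
    fix N assume "N \<in> set Ms"
    then obtain j where j: "j < length ns" "N = M j" by (auto simp: Ms_def)
    show "\<exists>U d. spectral_decomp (dim_row N) N U d \<and> (\<forall>i < dim_row N. 0 < d i)"
      using pos_def_spectral_decomp[OF Mpd[OF j(1)]] unfolding j(2) dimM[OF j(1)] by metis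
  qed
  obtain U d where U: "spectral_decomp n (diag_block_mat Ms) U d"
    and d: "\<And>a. a < n \<Longrightarrow> 0 < d a \<and>
      (\<exists>j < length Ms. \<exists>x \<in> carrier_vec (dim_row (Ms ! j)). d a = qform (Ms ! j) x \<and>
        col U a = block_embedding n (sum_list (map dim_row (take j Ms))) (dim_row (Ms ! j)) *\<^sub>v x)"
    using diag_block_mat_spectral_decomp[OF Ms_spec] unfolding dims assms(3) by blast
  obtain V \<mu> where V: "spectral_decomp n B V \<mu>" and \<mu>: "\<And>k. k < n \<Longrightarrow> 0 < \<mu> k"
    using pos_def_spectral_decomp[OF Bpd] by blast
  have Uc: "U \<in> carrier_mat n n" using U by (auto simp: spectral_decomp_def unitary_mat_def)
  define q where "q k a = (cmod ((mat_adjoint V * U) $$ (k, a)))\<^sup>2" for k a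
  have Z: "unitary_mat n (mat_adjoint V * U)"
    using U V by (intro unitary_mat_mult unitary_mat_adjoint) (auto simp: spectral_decomp_def)
  have col: "(\<Sum>k<n. q k a) = 1" if "a < n" for a
    unfolding q_def by (rule unitary_col_norm[OF Z that])
  have row: "(\<Sum>a<n. q k a) = 1" if "k < n" for k
    unfolding q_def by (rule unitary_row_norm[OF Z that])
  \<comment> \<open>Since \<open>col U a\<close> lies in the range of one \<open>E j\<close>, the form of \<open>B\<close> there dominates the eigenvalue \<open>d a\<close>.\<close>
  have le: "d a \<le> (\<Sum>k<n. q k a * \<mu> k)" if a: "a < n" for a
  proof -
    obtain j x where j: "j < length Ms" and x: "x \<in> carrier_vec (dim_row (Ms ! j))"
      and da: "d a = qform (Ms ! j) x"
      and Ua: "col U a = block_embedding n (sum_list (map dim_row (take j Ms))) (dim_row (Ms ! j)) *\<^sub>v x"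
      using d[OF a] by blast
    have j': "j < length ns" "Ms ! j = M j" using j by (auto simp: Ms_def)
    have "col U a = E j *\<^sub>v x"
      unfolding Ua E_def j'(2) dimM[OF j'(1)] by (simp add: dims flip: take_map)
    then have "d a \<le> qform B (col U a)"
      using compare[OF j'(1), of x] x da by (simp add: j' dimM)
    then show ?thesis unfolding qform_spectral_expansion[OF V Uc a] q_def .
  qed
  have "map (\<lambda>a. d a powr p) [0..<n] \<prec>\<^sub>w map (\<lambda>k. \<mu> k powr p) [0..<n]"
  proof (rule weakly_majorized_of_doubly_stochastic[of n q])
    fix a assume a: "a < n"
    have "d a powr p \<le> (\<Sum>k<n. q k a * \<mu> k) powr p"
      using le[OF a] d[OF a] assms(6) by (intro powr_mono2) auto
    also have "\<dots> \<le> (\<Sum>k<n. q k a * \<mu> k powr p)"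
      using assms(6) \<mu> col[OF a] by (intro powr_weighted_sum_le) (auto simp: q_def)
    finally show "d a powr p \<le> (\<Sum>k<n. q k a * \<mu> k powr p)" .
  qed (auto simp: col row, simp add: q_def)
  then have "eigvals (mat_powr (diag_block_mat Ms) p) \<prec>\<^sub>w eigvals (mat_powr B p)"
    using weakly_majorized_cong[OF mset_eigvals_mat_powr[OF U] mset_eigvals_mat_powr[OF V \<mu>]] d by simp
  then show ?thesis unfolding Ms_def B_def M_def .
qed

end
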